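(* For $a\in\mathbb{R}$, the function $$x\mapsto \frac{a-\frac12\log(1-x)}{K(x)}$$ is strictly convex on $(0,1)$ if and only if $a\le\log 4$, and strictly concave on $(0,1)$ if and only if $a\ge 8/5$.
   Context: $K(x)={\cal K}(\sqrt x)=\frac\pi2\,{}_2F_1(1/2,1/2;1;x)$ for $x\in[0,1)$, where ${\cal K}(r)=\int_0^{\pi/2}(1-r^2\sin^2t)^{-1/2}dt$ is the complete elliptic integral of the first kind and ${}_2F_1$ is the Gauss hypergeometric function. *)

theory Defs
  imports "HOL-Analysis.Analysis"
begin

text \<open>Complete elliptic integral of the first kind, in the parameter form
  K(x) = \<K>(sqrt x) = integral over [0, pi/2] of (1 - x sin^2 t)^(-1/2).\<close>
definition ellK :: "real \<Rightarrow> real" where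
  "ellK x = integral {0..pi/2} (\<lambda>t. 1 / sqrt (1 - x * (sin t)^2))"

definition strictly_convex_on :: "real set \<Rightarrow> (real \<Rightarrow> real) \<Rightarrow> bool" where
  "strictly_convex_on S f \<longleftrightarrow> convex S \<and>
     (\<forall>x\<in>S. \<forall>y\<in>S. \<forall>u::real. x \<noteq> y \<and> 0 < u \<and> u < 1 \<longrightarrow>
        f (u * x + (1 - u) * y) < u * f x + (1 - u) * f y)"

definition strictly_concave_on :: "real set \<Rightarrow> (real \<Rightarrow> real) \<Rightarrow> bool" where
  "strictly_concave_on S f \<longleftrightarrow> strictly_convex_on S (\<lambda>x. - f x)"

end

theory Submission
  imports Defs "HOL-Real_Asymp.Real_Asymp"
begin

text \<open>
  Write \<open>D(x)\<close> for the integral of \<open>sin\<^sup>2 t / sqrt (1 - x sin\<^sup>2 t)\<close> over \<open>[0, pi/2]\<close> and \<open>w = D/K\<close>.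
  Then \<open>K' = K (1 - w) / (2 (1 - x))\<close>, and \<open>w\<close> solves the Riccati equation
  \<open>w' = (1 - 2 w + x w\<^sup>2) / (2 x (1 - x))\<close> with \<open>w(0) = 1/2\<close>. The second derivative of the quotient is a
  positive factor times \<open>H - a\<close>, where \<open>H = ln (1 - x) / 2 + 2 x w / (2 w - 1 + x (1 - 2 w\<^sup>2))\<close> does not
  depend on \<open>a\<close>. The derivative of \<open>H\<close> is a negative factor times \<open>(6 x - 4) w\<^sup>2 - 4 w + 3 - x\<close>,
  which is positive by a barrier argument for the Riccati equation. So \<open>H\<close> decreases strictly from its limit
  \<open>8/5\<close> at \<open>0\<close> to its limit \<open>ln 4\<close> at \<open>1\<close>; the latter comes from \<open>K(x) = ln (16 / (1 - x)) / 2 + o(1)\<close>.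
\<close>

section \<open>Derivatives of the elliptic integrals\<close>

text \<open>This is the classical \<open>D = (K - E) / x\<close>, with \<open>E\<close> the complete
  integral of the second kind; unlike that quotient, the integral makes sense at
  \<open>x = 0\<close> too.\<close>

definition ellD :: "real \<Rightarrow> real" where
  "ellD x = integral {0..pi/2} (\<lambda>t. (sin t)^2 / sqrt (1 - x * (sin t)^2))"

definition ellW :: "real \<Rightarrow> real" where
  "ellW x = ellD x / ellK x"

lemma modulus_pos:
  fixes x t :: real
  assumes "x < 1"
  shows "1 - x * (sin t)^2 > 0"
proof (cases "x \<le> 0")
  case True
  then have "x * (sin t)^2 \<le> 0" by (simp add: mult_nonpos_nonneg)
  then show ?thesis by linarith
next
  case False
  have "(sin t)^2 \<le> 1" by (simp add: abs_square_le_1)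
  then have "x * (sin t)^2 \<le> x * 1" using False by (intro mult_left_mono) auto
  then show ?thesis using assms by linarith
qed

lemma moment_integrable:
  assumes "x < 1"
  shows "(\<lambda>t. (sin t)^n / sqrt (1 - x * (sin t)^2) ^ k) integrable_on {a..b}"
proof -
  have nz: "x * (sin t)^2 \<noteq> 1" for t using modulus_pos[OF assms, of t] by simp
  show ?thesis by (intro integrable_continuous_interval continuous_intros) (simp add: nz)
qed

lemma inverse_sqrt_has_derivative:
  fixes z s :: real
  assumes "1 - z * s^2 > 0"
  shows "((\<lambda>x. s^n / sqrt (1 - x * s^2)) has_field_derivative
       s^(n+2) / sqrt (1 - z * s^2) ^ 3 / 2) (at z within A)"
proof -
  define r where "r = sqrt (1 - z * s^2)"
  have r: "r > 0" using assms by (simp add: r_def)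
  have "((\<lambda>x. 1 - x * s^2) has_field_derivative - (s^2)) (at z within A)"
    by (auto intro!: derivative_eq_intros)
  from DERIV_chain2[OF DERIV_real_sqrt[OF assms] this]
  have "((\<lambda>x. sqrt (1 - x * s^2)) has_field_derivative inverse r / 2 * - (s^2)) (at z within A)"
    by (simp only: r_def)
  from DERIV_divide[OF DERIV_const this, of "s^n"]
  have "((\<lambda>x. s^n / sqrt (1 - x * s^2)) has_field_derivative
       (0 * r - s^n * (inverse r / 2 * - (s^2))) / (r * r)) (at z within A)"
    using r by (simp add: r_def)
  also have "(0 * r - s^n * (inverse r / 2 * - (s^2))) / (r * r) = s^(n+2) / r ^ 3 / 2"
    using r by (simp add: field_simps power_add power2_eq_square power3_eq_cube)
  finally show ?thesis unfolding r_def .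
qed

text \<open>Differentiation under the integral sign over the open half-line \<open>{..<1}\<close>. A
  separate \<open>m\<close> lets numerals be instantiated without normalising
  \<open>n + 2\<close>.\<close>

lemma moment_has_derivative:
  assumes "x < 1" and m: "m = n + 2"
  shows "((\<lambda>x. integral {0..pi/2} (\<lambda>t. (sin t)^n / sqrt (1 - x * (sin t)^2))) has_field_derivative
      integral {0..pi/2} (\<lambda>t. (sin t)^m / sqrt (1 - x * (sin t)^2) ^ 3) / 2) (at x)"
proof -
  have "((\<lambda>x. integral (cbox 0 (pi/2)) (\<lambda>t. (sin t)^n / sqrt (1 - x * (sin t)^2))) has_field_derivative
      integral (cbox 0 (pi/2)) (\<lambda>t. (sin t)^m / sqrt (1 - x * (sin t)^2) ^ 3 / 2)) (at x within {..<1})"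
  proof (rule leibniz_rule_field_derivative)
    fix z t :: real assume "z \<in> {..<1}"
    then show "((\<lambda>x. (sin t)^n / sqrt (1 - x * (sin t)^2)) has_field_derivative
       (sin t)^m / sqrt (1 - z * (sin t)^2) ^ 3 / 2) (at z within {..<1})"
      unfolding m by (intro inverse_sqrt_has_derivative modulus_pos) auto
  next
    fix z :: real assume "z \<in> {..<1}"
    then show "(\<lambda>t. (sin t)^n / sqrt (1 - z * (sin t)^2)) integrable_on cbox 0 (pi/2)"
      using moment_integrable[of z n 1] by simp
  next
    have "1 - fst p * (sin (snd p))^2 \<noteq> 0" if "p \<in> {..<1} \<times> cbox 0 (pi/2)" for p :: "real \<times> real"
      using modulus_pos[of "fst p" "snd p"] that by auto
    then show "continuous_on ({..<1} \<times> cbox 0 (pi/2))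
       (\<lambda>(x, t). (sin t)^m / sqrt (1 - x * (sin t)^2) ^ 3 / 2)"
      unfolding case_prod_unfold by (intro continuous_intros) auto
  qed (use assms in auto)
  moreover have "at x within {..<1} = at x" using assms(1) by (intro at_within_open) auto
  ultimately show ?thesis by (simp only: integral_divide cbox_interval)
qed

text \<open>The integrand is the derivative of
  \<open>sin t * cos t / sqrt (1 - x * (sin t)^2)\<close>, which vanishes at both ends. This exact
  term expresses moments with the cubed root through \<open>ellK\<close> and
  \<open>ellD\<close>.\<close>

lemma has_integral_sin_cos_over_modulus:
  assumes "x < 1"
  shows "((\<lambda>t. ((cos t)^2 - (sin t)^2 + x * (sin t)^4) / sqrt (1 - x * (sin t)^2) ^ 3) has_integral 0) {0..pi/2}"
proof -
  let ?F = "\<lambda>t. sin t * cos t / sqrt (1 - x * (sin t)^2)"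
  have "((\<lambda>t. ((cos t)^2 - (sin t)^2 + x * (sin t)^4) / sqrt (1 - x * (sin t)^2) ^ 3)
      has_integral ?F (pi/2) - ?F 0) {0..pi/2}"
  proof (rule fundamental_theorem_of_calculus)
    fix t :: real
    define r where "r = sqrt (1 - x * (sin t)^2)"
    have p: "1 - x * (sin t)^2 > 0" by (rule modulus_pos[OF assms])
    then have r: "r > 0" "r^2 = 1 - x * (sin t)^2" by (auto simp: r_def)
    have "((\<lambda>t. 1 - x * (sin t)^2) has_field_derivative - (x * (2 * sin t * cos t))) (at t within {0..pi/2})"
      by (auto intro!: derivative_eq_intros)
    from DERIV_chain2[OF DERIV_real_sqrt[OF p] this]
    have dr: "((\<lambda>t. sqrt (1 - x * (sin t)^2)) has_field_derivative
       inverse r / 2 * - (x * (2 * sin t * cos t))) (at t within {0..pi/2})"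
      by (simp only: r_def)
    have "((\<lambda>t. sin t * cos t) has_field_derivative (cos t)^2 - (sin t)^2) (at t within {0..pi/2})"
      by (auto intro!: derivative_eq_intros simp: power2_eq_square)
    from DERIV_divide[OF this dr]
    have "(?F has_real_derivative (((cos t)^2 - (sin t)^2) * r
        - sin t * cos t * (inverse r / 2 * - (x * (2 * sin t * cos t)))) / (r * r)) (at t within {0..pi/2})"
      using r(1) by (simp add: r_def)
    also have "(((cos t)^2 - (sin t)^2) * r
        - sin t * cos t * (inverse r / 2 * - (x * (2 * sin t * cos t)))) / (r * r)
       = (((cos t)^2 - (sin t)^2) * r^2 + x * (sin t * cos t)^2) / r^3"
      using r(1) by (simp add: field_simps power2_eq_square power3_eq_cube)
    also have "((cos t)^2 - (sin t)^2) * r^2 + x * (sin t * cos t)^2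
       = (cos t)^2 - (sin t)^2 + x * (sin t)^4"
      unfolding r(2) by (simp add: algebra_simps power2_eq_square power4_eq_xxxx)
    finally show "(?F has_vector_derivative ((cos t)^2 - (sin t)^2 + x * (sin t)^4) / sqrt (1 - x * (sin t)^2) ^ 3) (at t within {0..pi/2})"
      by (simp add: has_real_derivative_iff_has_vector_derivative r_def)
  qed simp
  then show ?thesis by simp
qed

text \<open>Differentiating the integrand gives \<open>?J / 2\<close>. The combination
  \<open>K - D - (1 - x) * ?J\<close> integrates the exact derivative above, so it is 0 and
  determines \<open>?J\<close>.\<close>

lemma ellK_has_derivative:
  assumes "x < 1"
  shows "(ellK has_field_derivative (ellK x - ellD x) / (2 * (1 - x))) (at x)"
proof -
  let ?J = "integral {0..pi/2} (\<lambda>t. (sin t)^2 / sqrt (1 - x * (sin t)^2) ^ 3)"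
  have d: "(ellK has_field_derivative ?J / 2) (at x)"
    using moment_has_derivative[OF assms, of 2 0] by (simp add: ellK_def[abs_def])
  note I = moment_integrable[OF assms, THEN integrable_integral]
  have "((\<lambda>t. 1 / sqrt (1 - x * (sin t)^2) - (sin t)^2 / sqrt (1 - x * (sin t)^2)
        - (1 - x) * ((sin t)^2 / sqrt (1 - x * (sin t)^2) ^ 3)) has_integral
      ellK x - ellD x - (1 - x) * ?J) {0..pi/2}"
    using has_integral_diff[OF has_integral_diff[OF I[of 0 1] I[of 2 1]] has_integral_mult_right[OF I[of 2 3]]]
    by (simp only: ellK_def ellD_def power_0 power_one_right)
  moreover have "1 / sqrt (1 - x * (sin t)^2) - (sin t)^2 / sqrt (1 - x * (sin t)^2)
        - (1 - x) * ((sin t)^2 / sqrt (1 - x * (sin t)^2) ^ 3)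
      = ((cos t)^2 - (sin t)^2 + x * (sin t)^4) / sqrt (1 - x * (sin t)^2) ^ 3" for t
  proof -
    define r where "r = sqrt (1 - x * (sin t)^2)"
    have r: "r > 0" "r^2 = 1 - x * (sin t)^2" using modulus_pos[OF assms, of t] by (auto simp: r_def)
    have "1 / r - (sin t)^2 / r - (1 - x) * ((sin t)^2 / r ^ 3)
      = ((1 - (sin t)^2) * r^2 - (1 - x) * (sin t)^2) / r^3"
      using r(1) by (simp add: divide_simps) (simp add: algebra_simps power2_eq_square power3_eq_cube)
    also have "(1 - (sin t)^2) * r^2 - (1 - x) * (sin t)^2 = (cos t)^2 - (sin t)^2 + x * (sin t)^4"
      unfolding r(2) cos_squared_eq by (simp add: algebra_simps power2_eq_square power4_eq_xxxx)
    finally show ?thesis unfolding r_def .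
  qed
  ultimately have "((\<lambda>t. ((cos t)^2 - (sin t)^2 + x * (sin t)^4) / sqrt (1 - x * (sin t)^2) ^ 3)
      has_integral ellK x - ellD x - (1 - x) * ?J) {0..pi/2}" by (simp only:)
  then have "ellK x - ellD x - (1 - x) * ?J = 0"
    by (rule has_integral_unique[OF _ has_integral_sin_cos_over_modulus[OF assms]])
  then have "?J / 2 = (ellK x - ellD x) / (2 * (1 - x))" using assms by (simp add: field_simps)
  with d show ?thesis by simp
qed

lemma ellD_has_derivative_moment:
  assumes "x < 1"
  shows "(ellD has_field_derivative
     integral {0..pi/2} (\<lambda>t. (sin t)^4 / sqrt (1 - x * (sin t)^2) ^ 3) / 2) (at x)"
  using moment_has_derivative[OF assms, of 4 2] by (simp add: ellD_def[abs_def])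

text \<open>With \<open>r\<close> the root, \<open>1 - r^2 = x * (sin t)^2\<close> gives
  \<open>x * ?L = ?J - D\<close>, where \<open>?J\<close> is known from the derivative of
  \<open>ellK\<close>. Solving for \<open>?L\<close> divides by \<open>x\<close>; the point 0 is
  treated in \<open>ellD_has_derivative_0\<close>.\<close>

lemma ellD_has_derivative:
  assumes "x < 1" "x \<noteq> 0"
  shows "(ellD has_field_derivative (ellK x - (2 - x) * ellD x) / (2 * x * (1 - x))) (at x)"
proof -
  let ?J = "integral {0..pi/2} (\<lambda>t. (sin t)^2 / sqrt (1 - x * (sin t)^2) ^ 3)"
  let ?L = "integral {0..pi/2} (\<lambda>t. (sin t)^4 / sqrt (1 - x * (sin t)^2) ^ 3)"
  have "(ellK has_field_derivative ?J / 2) (at x)"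
    using moment_has_derivative[OF assms(1), of 2 0] by (simp add: ellK_def[abs_def])
  then have J: "?J / 2 = (ellK x - ellD x) / (2 * (1 - x))"
    using ellK_has_derivative[OF assms(1)] by (rule DERIV_unique)
  note I = moment_integrable[OF assms(1), THEN integrable_integral]
  have "((\<lambda>t. (sin t)^2 / sqrt (1 - x * (sin t)^2) ^ 3 - (sin t)^2 / sqrt (1 - x * (sin t)^2))
      has_integral ?J - ellD x) {0..pi/2}"
    using has_integral_diff[OF I[of 2 3] I[of 2 1]] by (simp only: ellD_def power_one_right)
  moreover have "(sin t)^2 / sqrt (1 - x * (sin t)^2) ^ 3 - (sin t)^2 / sqrt (1 - x * (sin t)^2)
     = x * ((sin t)^4 / sqrt (1 - x * (sin t)^2) ^ 3)" for t
  proof -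
    define r where "r = sqrt (1 - x * (sin t)^2)"
    have r: "r > 0" "r^2 = 1 - x * (sin t)^2" using modulus_pos[OF assms(1), of t] by (auto simp: r_def)
    have "(sin t)^2 / r ^ 3 - (sin t)^2 / r = (sin t)^2 * (1 - r^2) / r^3"
      using r(1) by (simp add: divide_simps) (simp add: algebra_simps power2_eq_square power3_eq_cube)
    then show ?thesis unfolding r(2) unfolding r_def by (simp add: power2_eq_square power4_eq_xxxx)
  qed
  ultimately have "((\<lambda>t. x * ((sin t)^4 / sqrt (1 - x * (sin t)^2) ^ 3))
      has_integral ?J - ellD x) {0..pi/2}" by (simp only:)
  then have "x * ?L = ?J - ellD x"
    by (rule has_integral_unique[OF has_integral_mult_right[OF I[of 4 3]]])
  moreover have "?J = (ellK x - ellD x) / (1 - x)" using J assms by (simp add: field_simps)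
  ultimately have "?L = ((ellK x - ellD x) / (1 - x) - ellD x) / x"
    using assms by (simp add: eq_divide_eq mult.commute)
  also have "\<dots> = (ellK x - (2 - x) * ellD x) / (x * (1 - x))"
    using assms by (simp add: divide_simps) (simp add: algebra_simps)
  finally have "?L / 2 = (ellK x - (2 - x) * ellD x) / (2 * x * (1 - x))" by simp
  with ellD_has_derivative_moment[OF assms(1)] show ?thesis by simp
qed

section \<open>Signs of the integrals, values at 0, and the Riccati equation\<close>

lemma has_integral_sin_squared: "((\<lambda>t. (sin t)^2) has_integral pi/4) {0..pi/2}"
proof -
  have "((\<lambda>t. (sin t)^2) has_integral (pi/2 - sin (pi/2) * cos (pi/2)) / 2 - (0 - sin 0 * cos 0) / 2) {0..pi/2}"
    by (rule fundamental_theorem_of_calculus)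
       (auto simp flip: has_real_derivative_iff_has_vector_derivative simp: cos_squared_eq power2_eq_square
         intro!: derivative_eq_intros, simp add: cos_squared_eq flip: power2_eq_square)
  then show ?thesis by simp
qed

text \<open>The function \<open>sin^3 * cos\<close> vanishes at both ends, and its derivative
  reduces the fourth moment to the second.\<close>

lemma has_integral_sin_fourth: "((\<lambda>t. (sin t)^4) has_integral 3*pi/16) {0..pi/2}"
proof -
  have "((\<lambda>t. 3 * (sin t)^2 - 4 * (sin t)^4) has_integral (sin (pi/2)^3 * cos (pi/2)) - (sin 0^3 * cos 0)) {0..pi/2}"
  proof (rule fundamental_theorem_of_calculus)
    fix t :: real
    have "((\<lambda>t. sin t^3 * cos t) has_real_derivative 3 * (sin t)^2 * (cos t)^2 - sin t^4) (at t within {0..pi/2})"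
      by (rule derivative_eq_intros refl)+ (simp add: power2_eq_square power4_eq_xxxx power3_eq_cube)
    also have "3 * (sin t)^2 * (cos t)^2 - sin t^4 = 3 * (sin t)^2 - 4 * (sin t)^4"
      unfolding cos_squared_eq by (simp add: algebra_simps flip: power_add)
    finally show "((\<lambda>t. sin t^3 * cos t) has_vector_derivative 3 * (sin t)^2 - 4 * (sin t)^4) (at t within {0..pi/2})"
      by (simp add: has_real_derivative_iff_has_vector_derivative)
  qed simp
  from has_integral_diff[OF has_integral_mult_right[OF has_integral_sin_squared, of 3] this]
  have "((\<lambda>t. 4 * (sin t)^4) has_integral 3 * pi / 4) {0..pi/2}" by simp
  from has_integral_mult_right[OF this, of "1/4"] show ?thesis by simp
qed

text \<open>Serves the weights \<open>1\<close>, \<open>sin^2\<close> and \<open>cos^2\<close>, that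
  is \<open>K\<close>, \<open>D\<close> and \<open>K - D\<close>. The last two weights vanish at an
  endpoint, so positivity is asked only inside.\<close>

lemma weighted_integral_pos:
  assumes "x < 1" "continuous_on {0..pi/2} g" and g: "\<And>t. 0 < t \<Longrightarrow> t < pi/2 \<Longrightarrow> g t > 0"
  shows "integral {0..pi/2} (\<lambda>t. g t / sqrt (1 - x * (sin t)^2)) > 0"
proof -
  have "x * (sin t)^2 \<noteq> 1" for t using modulus_pos[OF assms(1), of t] by simp
  then have c: "continuous_on {0..pi/2} (\<lambda>t. g t / sqrt (1 - x * (sin t)^2))"
    using assms(2) by (intro continuous_intros) simp_all
  have "g t / sqrt (1 - x * (sin t)^2) > 0" if "t \<in> {0<..<pi/2}" for t
    using that g[of t] modulus_pos[OF assms(1), of t] by (intro divide_pos_pos) simp_all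
  then have "integral {0..pi/2} (\<lambda>t. 0) < integral {0..pi/2} (\<lambda>t. g t / sqrt (1 - x * (sin t)^2))"
    using c by (intro integral_less_real) (simp_all add: not_le)
  then show ?thesis by simp
qed

lemma ellK_pos: "x < 1 \<Longrightarrow> ellK x > 0"
  using weighted_integral_pos[of x "\<lambda>_. 1"] by (simp add: ellK_def)

lemma ellD_pos:
  assumes "x < 1"
  shows "ellD x > 0"
  unfolding ellD_def
proof (rule weighted_integral_pos[OF assms])
  fix t :: real assume "0 < t" "t < pi/2"
  then have "sin t > 0" by (intro sin_gt_zero) auto
  then show "(sin t)^2 > 0" by simp
qed (intro continuous_intros)

lemma ellD_less_ellK:
  assumes "x < 1"
  shows "ellD x < ellK x"
proof -
  have "0 < integral {0..pi/2} (\<lambda>t. (cos t)^2 / sqrt (1 - x * (sin t)^2))"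
  proof (rule weighted_integral_pos[OF assms])
    fix t :: real assume "0 < t" "t < pi/2"
    then have "cos t > 0" by (intro cos_gt_zero)
    then show "(cos t)^2 > 0" by simp
  qed (intro continuous_intros)
  also have "\<dots> = ellK x - ellD x"
    using moment_integrable[OF assms, of 0 1] moment_integrable[OF assms, of 2 1]
    by (simp add: cos_squared_eq diff_divide_distrib integral_diff ellK_def ellD_def)
  finally show ?thesis by simp
qed

lemma ellW_pos: "x < 1 \<Longrightarrow> ellW x > 0"
  by (simp add: ellW_def ellK_pos ellD_pos)

lemma ellW_less_1: "x < 1 \<Longrightarrow> ellW x < 1"
  by (simp add: ellW_def ellK_pos ellD_less_ellK)

lemma ellK_0: "ellK 0 = pi/2" by (simp add: ellK_def)

lemma ellD_0: "ellD 0 = pi/4"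
  using has_integral_sin_squared by (simp add: ellD_def integral_unique)

lemma ellD_has_derivative_0: "(ellD has_field_derivative 3*pi/32) (at 0)"
  using ellD_has_derivative_moment[of 0] has_integral_sin_fourth by (simp add: integral_unique)

lemma ellK_has_derivative_ellW:
  assumes "x < 1"
  shows "(ellK has_field_derivative ellK x * (1 - ellW x) / (2 * (1 - x))) (at x)"
  using ellK_has_derivative[OF assms] ellK_pos[OF assms] by (simp add: ellW_def algebra_simps)

text \<open>\<open>K\<close> and \<open>D\<close> solve a homogeneous linear first-order system, so
  in the derivative of their ratio \<open>K\<close> cancels and a Riccati equation remains.\<close>

lemma ellW_has_derivative:
  assumes "0 < x" "x < 1"
  shows "(ellW has_field_derivative (1 - 2 * ellW x + x * (ellW x)^2) / (2 * x * (1 - x))) (at x)"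
proof -
  have K: "ellK x > 0" using assms ellK_pos by auto
  have "(ellW has_field_derivative ((ellK x - (2 - x) * ellD x) / (2 * x * (1 - x)) * ellK x
     - ellD x * ((ellK x - ellD x) / (2 * (1 - x)))) / (ellK x * ellK x)) (at x)"
    unfolding ellW_def[abs_def]
    using assms K by (intro DERIV_divide ellD_has_derivative ellK_has_derivative) auto
  also have "((ellK x - (2 - x) * ellD x) / (2 * x * (1 - x)) * ellK x
     - ellD x * ((ellK x - ellD x) / (2 * (1 - x)))) / (ellK x * ellK x)
    = (1 - 2 * ellW x + x * (ellW x)^2) / (2 * x * (1 - x))"
    using assms K by (simp add: ellW_def divide_simps) (simp add: algebra_simps power2_eq_square)
  finally show ?thesis .
qed

lemma ellW_0: "ellW 0 = 1/2" by (simp add: ellW_def ellK_0 ellD_0)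

text \<open>The Riccati right-hand side is 0/0 at the origin, so the slope comes from the
  derivatives of \<open>ellD\<close> and \<open>ellK\<close>. It determines the constant
  8/5.\<close>

lemma ellW_has_derivative_0: "(ellW has_field_derivative 1/16) (at 0)"
proof -
  have "(ellW has_field_derivative (3*pi/32 * ellK 0 - ellD 0 * ((ellK 0 - ellD 0) / (2 * (1 - 0)))) / (ellK 0 * ellK 0)) (at 0)"
    unfolding ellW_def[abs_def]
    using ellK_pos[of 0] by (intro DERIV_divide ellD_has_derivative_0 ellK_has_derivative) auto
  then show ?thesis by (simp add: ellK_0 ellD_0 field_simps)
qed

lemma continuous_on_ellW: "continuous_on {0..<1} ellW"
proof (intro continuous_at_imp_continuous_on ballI)
  fix x :: real assume "x \<in> {0..<1}"
  then show "isCont ellW x"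
    using ellW_has_derivative_0 ellW_has_derivative[of x] DERIV_isCont by (cases "x = 0") auto
qed

section \<open>The Riccati equation and the monotonicity of \<open>H\<close>\<close>

text \<open>If \<open>\<phi> x \<le> 0\<close>, then \<open>\<phi>\<close> has a minimum over
  \<open>{0..x}\<close> at some positive point with value at most 0; the positive slope there yields
  smaller values just to the left.\<close>

lemma positive_by_barrier:
  fixes \<phi> :: "real \<Rightarrow> real"
  assumes cont: "continuous_on {0..<1} \<phi>" and zero: "\<phi> 0 = 0"
    and deriv: "\<And>x. 0 < x \<Longrightarrow> x < 1 \<Longrightarrow> (\<phi> has_field_derivative \<phi>' x) (at x)"
    and up: "\<And>x. 0 < x \<Longrightarrow> x < 1 \<Longrightarrow> \<phi> x \<le> 0 \<Longrightarrow> \<phi>' x > 0"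
    and x: "0 < x" "x < 1"
  shows "\<phi> x > 0"
proof (rule ccontr)
  assume neg: "\<not> \<phi> x > 0"
  have "continuous_on {0..x} \<phi>" using cont by (rule continuous_on_subset) (use x in auto)
  then obtain m where m: "m \<in> {0..x}" "\<And>z. z \<in> {0..x} \<Longrightarrow> \<phi> m \<le> \<phi> z"
    using continuous_attains_inf[of "{0..x}" \<phi>] x by auto
  \<comment> \<open>A minimum at 0 has value 0, so \<open>\<phi> x \<le> 0\<close> makes
    \<open>x\<close> a minimum point as well.\<close>
  obtain n where n: "0 < n" "n \<le> x" "\<And>z. z \<in> {0..x} \<Longrightarrow> \<phi> n \<le> \<phi> z"
  proof (cases "m = 0")
    case True
    then have "\<phi> x \<le> \<phi> z" if "z \<in> {0..x}" for z using m(2)[OF that] neg zero by simp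
    then show ?thesis using that x by auto
  qed (use m in \<open>auto intro!: that[of m]\<close>)
  have "\<phi> n \<le> 0" using n(3)[of x] neg x by simp
  then have "\<phi>' n > 0" using n x up by auto
  from DERIV_pos_inc_left[OF deriv this] obtain d where
    d: "d > 0" "\<And>h. 0 < h \<Longrightarrow> h < d \<Longrightarrow> \<phi> (n - h) < \<phi> n" using n x by auto
  define h where "h = min (d/2) n"
  have "\<phi> (n - h) < \<phi> n" using d(1) n(1) by (intro d(2)) (auto simp: h_def)
  moreover have "\<phi> n \<le> \<phi> (n - h)" using n d(1) by (intro n(3)) (auto simp: h_def)
  ultimately show False by simp
qed

text \<open>This is the numerator \<open>c\<close> of the Riccati right-hand side. Substituting the
  equation into \<open>c'\<close> leaves \<open>w^2\<close> plus a negative multiple of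
  \<open>c\<close>, hence \<open>c' > 0\<close> wherever \<open>c \<le> 0\<close>.\<close>

lemma ellW_discriminant_pos:
  assumes "0 < x" "x < 1"
  shows "1 - 2 * ellW x + x * (ellW x)^2 > 0"
proof (rule positive_by_barrier[OF _ _ _ _ assms])
  show "continuous_on {0..<1} (\<lambda>x. 1 - 2 * ellW x + x * (ellW x)^2)"
    by (intro continuous_intros continuous_on_ellW)
  show "1 - 2 * ellW 0 + 0 * (ellW 0)^2 = 0" by (simp add: ellW_0)
next
  fix x :: real assume x: "0 < x" "x < 1"
  let ?c = "1 - 2 * ellW x + x * (ellW x)^2"
  show "((\<lambda>x. 1 - 2 * ellW x + x * (ellW x)^2) has_field_derivative
     (ellW x)^2 - (1 - x * ellW x) * ?c / (x * (1 - x))) (at x)"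
    using x by (auto intro!: derivative_eq_intros ellW_has_derivative simp: divide_simps)
       (simp add: algebra_simps power2_eq_square)
  assume "?c \<le> 0"
  have "ellW x > 0" using x by (simp add: ellW_pos)
  moreover have "x * ellW x < 1" using mult_strict_mono[of x 1 "ellW x" 1] x
    by (simp add: ellW_less_1 ellW_pos less_imp_le)
  moreover from this have "(1 - x * ellW x) * ?c / (x * (1 - x)) \<le> 0"
    using x \<open>?c \<le> 0\<close> by (intro divide_nonpos_nonneg mult_nonneg_nonpos) auto
  ultimately show "(ellW x)^2 - (1 - x * ellW x) * ?c / (x * (1 - x)) > 0"
    using zero_less_power[of "ellW x" 2] by linarith
qed

lemma ellW_strict_mono:
  assumes "0 \<le> x" "x < y" "y < 1"
  shows "ellW x < ellW y"
proof (rule DERIV_pos_imp_increasing_open[OF assms(2)])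
  fix z assume z: "x < z" "z < y"
  then show "\<exists>d. (ellW has_real_derivative d) (at z) \<and> 0 < d"
    using ellW_has_derivative[of z] ellW_discriminant_pos[of z] assms
    by (intro exI[of _ "(1 - 2 * ellW z + z * (ellW z)^2) / (2 * z * (1 - z))"]) simp
next
  show "continuous_on {x..y} ellW"
    by (rule continuous_on_subset[OF continuous_on_ellW]) (use assms in auto)
qed

lemma ellW_gt_half: "0 < x \<Longrightarrow> x < 1 \<Longrightarrow> ellW x > 1/2"
  using ellW_strict_mono[of 0 x] by (simp add: ellW_0)

text \<open>The expression is linear in \<open>x\<close>: it is positive iff \<open>x > X(w)\<close> with
  \<open>X(w) = (2 w - 1)(2 w + 3) / (6 w\<^sup>2 - 1)\<close>, and both sides agree at \<open>x = 0\<close>.\<close>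

lemma ellW_barrier:
  assumes "0 < x" "x < 1"
  shows "(6 * x - 4) * (ellW x)^2 - 4 * ellW x + 3 - x > 0"
proof -
  define X where "X = (\<lambda>w::real. (2*w - 1) * (2*w + 3) / (6 * w^2 - 1))"
  have den: "6 * w^2 - 1 > 0" if "w \<ge> 1/2" for w :: real
  proof -
    have "w^2 \<ge> (1/2)^2" using that by (intro power_mono) auto
    then show ?thesis by (simp add: power2_eq_square)
  qed
  have half: "ellW x \<ge> 1/2" if "x \<in> {0..<1}" for x
    using that ellW_gt_half[of x] ellW_0 by (cases "x = 0") auto
  have "x - X (ellW x) > 0"
  proof (rule positive_by_barrier[OF _ _ _ _ assms])
    show "continuous_on {0..<1} (\<lambda>x. x - X (ellW x))"
      unfolding X_def using den half
      by (intro continuous_intros continuous_on_ellW) (metis less_irrefl)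
    show "0 - X (ellW 0) = 0" by (simp add: X_def ellW_0)
  next
    fix x :: real assume x: "0 < x" "x < 1"
    define w where "w = ellW x"
    define w' where "w' = (1 - 2 * w + x * w^2) / (2 * x * (1 - x))"
    have w: "w > 1/2" "6 * w^2 - 1 > 0" using ellW_gt_half[OF x] den by (auto simp: w_def)
    have "(X has_field_derivative 4 * (1 - w) * (6 * w - 1) / (6 * w^2 - 1)^2) (at w)"
      unfolding X_def using w
      by (auto intro!: derivative_eq_intros simp: divide_simps) 
         (simp add: algebra_simps power2_eq_square)
    then have dX: "((\<lambda>x. X (ellW x)) has_field_derivative 4 * (1 - w) * (6 * w - 1) / (6 * w^2 - 1)^2 * w') (at x)"
      unfolding w_def w'_def by (rule DERIV_chain2) (rule ellW_has_derivative[OF x])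
    show "((\<lambda>x. x - X (ellW x)) has_field_derivative
        1 - 4 * (1 - ellW x) * (6 * ellW x - 1) / (6 * (ellW x)^2 - 1)^2 * 
        ((1 - 2 * ellW x + x * (ellW x)^2) / (2 * x * (1 - x)))) (at x)"
      using DERIV_diff[OF DERIV_ident dX] by (simp add: w_def w'_def)
    assume le: "x - X (ellW x) \<le> 0"
    have w1: "w < 1" using x by (simp add: w_def ellW_less_1)
    let ?X = "X w"
    have X1: "1 - ?X = 2 * (1 - w)^2 / (6 * w^2 - 1)"
      using w by (simp add: X_def divide_simps) (simp add: algebra_simps power2_eq_square)
    then have X: "?X < 1" using w w1 by (smt (verit) divide_pos_pos zero_less_power)
    \<comment> \<open>Both \<open>w^2 - (2 * w - 1) / x\<close> and \<open>1 / (1 - x)\<close>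
      increase with \<open>x\<close>, so \<open>w'\<close> is at most its value with
      \<open>?X\<close> in place of \<open>x\<close>. Positivity of the numerator allows the two
      bounds to be combined.\<close>
    have xX: "x \<le> ?X" using le by (simp add: w_def)
    have c: "1 - 2 * w + x * w^2 > 0" using ellW_discriminant_pos[OF x] by (simp add: w_def)
    then have "(1 - 2 * w + x * w^2) / x > 0" using x by simp
    moreover have "(1 - 2 * w + x * w^2) / x = w^2 - (2 * w - 1) / x" using x by (simp add: field_simps)
    moreover have "w^2 - (2 * w - 1) / x \<le> w^2 - (2 * w - 1) / ?X"
      using xX x w by (intro diff_left_mono divide_left_mono) auto
    ultimately have "(1 - 2 * w + x * w^2) / x / (2 * (1 - x)) \<le> (w^2 - (2 * w - 1) / ?X) / (2 * (1 - ?X))"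
      using xX x X by (intro frac_le) (linarith | simp)+
    also have "w^2 - (2 * w - 1) / ?X = w^2 - (6 * w^2 - 1) / (2 * w + 3)"
      using w by (simp add: X_def)
    also have "\<dots> = (1 - w)^2 * (2 * w + 1) / (2 * w + 3)"
      using w by (simp add: field_simps) (simp add: algebra_simps power2_eq_square power3_eq_cube)
    also have "\<dots> / (2 * (1 - ?X)) = (2 * w + 1) * (6 * w^2 - 1) / (4 * (2 * w + 3))"
      unfolding X1 using w w1 by simp
    finally have w': "w' \<le> (2 * w + 1) * (6 * w^2 - 1) / (4 * (2 * w + 3))"
      by (simp only: w'_def divide_divide_eq_left mult_ac)
    \<comment> \<open>Free factors keep the polynomials unexpanded while
      \<open>R = 6 * w^2 - 1\<close> cancels.\<close>
    have cancel: "4 * a * b / R^2 * (c * R / (4 * d)) = a * b * c / (R * d)" if "R > 0" for a b c d R :: real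
      using that by (simp add: power2_eq_square)
    have "4 * (1 - w) * (6 * w - 1) / (6 * w^2 - 1)^2 * w'
       \<le> 4 * (1 - w) * (6 * w - 1) / (6 * w^2 - 1)^2 * ((2 * w + 1) * (6 * w^2 - 1) / (4 * (2 * w + 3)))"
      using w w1 by (intro mult_left_mono w') auto
    also have "\<dots> = (1 - w) * (6 * w - 1) * (2 * w + 1) / ((6 * w^2 - 1) * (2 * w + 3))"
      by (rule cancel[OF w(2)])
    also have "\<dots> < 1"
    proof -
      \<comment> \<open>The difference vanishes at \<open>w = 1/2\<close>, because the barrier and
        the solution are tangent at \<open>x = 0\<close>; this explains the factor
        \<open>2 * w - 1\<close>.\<close>
      have "(6 * w^2 - 1) * (2 * w + 3) - (1 - w) * (6 * w - 1) * (2 * w + 1) 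
          = (2 * w - 1) * (12 * w^2 + 11 * w + 2)"
        by (simp add: algebra_simps power2_eq_square)
      also have "\<dots> > 0" using w by (intro mult_pos_pos add_pos_pos) auto
      finally show ?thesis using w by simp
    qed
    finally show "1 - 4 * (1 - ellW x) * (6 * ellW x - 1) / (6 * (ellW x)^2 - 1)^2 * 
        ((1 - 2 * ellW x + x * (ellW x)^2) / (2 * x * (1 - x))) > 0"
      by (simp add: w_def w'_def)
  qed
  then have "X (ellW x) < x" by simp
  then have "(2 * ellW x - 1) * (2 * ellW x + 3) < x * (6 * (ellW x)^2 - 1)"
    using den[OF half[of x]] assms by (simp add: X_def divide_less_eq)
  then show ?thesis by (simp add: algebra_simps power2_eq_square)
qed

section \<open>The threshold function: monotonicity and limit at 0\<close>

definition ellH :: "real \<Rightarrow> real" where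
  "ellH x = ln (1 - x) / 2 + 2 * x * ellW x / (2 * ellW x - 1 + x * (1 - 2 * (ellW x)^2))"

text \<open>Positivity of the Riccati numerator gives \<open>1 - x < (1 - x * w)^2\<close>, and
  \<open>w > 1/2\<close> gives \<open>1 - x * w \<le> 2 * w\<close>. Hence
  \<open>1 - x < 2 * w * (1 - x * w)\<close>, which rearranges to the claim.\<close>

lemma ellH_denominator_pos:
  assumes "0 < x" "x < 1"
  shows "2 * ellW x - 1 + x * (1 - 2 * (ellW x)^2) > 0"
proof -
  have s: "1 - x * ellW x > 0" using mult_strict_mono[of x 1 "ellW x" 1] assms
    by (simp add: ellW_less_1 ellW_pos less_imp_le)
  have "(1 - x * ellW x)^2 - (1 - x) = x * (1 - 2 * ellW x + x * (ellW x)^2)"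
    by (simp add: algebra_simps power2_eq_square)
  also have "\<dots> > 0" using assms ellW_discriminant_pos[OF assms] by (intro mult_pos_pos)
  finally have "1 - x < (1 - x * ellW x)^2" by simp
  also have "\<dots> \<le> 2 * ellW x * (1 - x * ellW x)"
  proof -
    have "x * ellW x > 0" using assms by (simp add: ellW_pos)
    then have "1 - x * ellW x \<le> 2 * ellW x" using ellW_gt_half[OF assms] by linarith
    then show ?thesis unfolding power2_eq_square using s by (intro mult_right_mono) auto
  qed
  finally show ?thesis by (simp add: algebra_simps power2_eq_square)
qed

lemma ellH_has_derivative:
  assumes "0 < x" "x < 1"
  shows "(ellH has_field_derivative - ((6 * x - 4) * (ellW x)^2 - 4 * ellW x + 3 - x) 
     / (2 * (2 * ellW x - 1 + x * (1 - 2 * (ellW x)^2))^2)) (at x)"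
proof -
  define w where "w = ellW x"
  define Q where "Q = 2 * w - 1 + x * (1 - 2 * w^2)"
  define w' where "w' = (1 - 2 * w + x * w^2) / (2 * x * (1 - x))"
  have Q: "Q > 0" using ellH_denominator_pos[OF assms] by (simp add: Q_def w_def)
  have dw: "(ellW has_field_derivative w') (at x)"
    using ellW_has_derivative[OF assms] by (simp add: w_def w'_def)
  have "((\<lambda>x. 2 * ellW x - 1 + x * (1 - 2 * (ellW x)^2)) has_field_derivative
     2 * w' + (1 - 2 * w^2) - x * (4 * w * w')) (at x)"
    by (auto intro!: derivative_eq_intros dw simp: w_def)
  moreover have "((\<lambda>x. 2 * x * ellW x) has_field_derivative 2 * w + 2 * x * w') (at x)"
    by (auto intro!: derivative_eq_intros dw simp: w_def)
  ultimately have quotient: "((\<lambda>x. 2 * x * ellW x / (2 * ellW x - 1 + x * (1 - 2 * (ellW x)^2))) has_field_derivative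
     ((2 * w + 2 * x * w') * Q - 2 * x * w * (2 * w' + (1 - 2 * w^2) - x * (4 * w * w'))) / (Q * Q)) (at x)"
    using Q unfolding Q_def w_def by (intro DERIV_divide) auto
  have "((\<lambda>x. ln (1 - x) / 2) has_field_derivative - 1 / (2 * (1 - x))) (at x)"
    using assms by (auto intro!: derivative_eq_intros simp: divide_simps)
  from DERIV_add[OF this quotient]
  have "(ellH has_field_derivative - 1 / (2 * (1 - x)) + 
     ((2 * w + 2 * x * w') * Q - 2 * x * w * (2 * w' + (1 - 2 * w^2) - x * (4 * w * w'))) / (Q * Q)) (at x)"
    by (simp only: ellH_def[abs_def])
  \<comment> \<open>Terms with \<open>w'\<close> are collected into a multiple of
    \<open>2 * x * w'\<close>, ready for the Riccati equation.\<close>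
  also have "(2 * w + 2 * x * w') * Q - 2 * x * w * (2 * w' + (1 - 2 * w^2) - x * (4 * w * w'))
     = (2 * w * Q - 2 * x * w * (1 - 2 * w^2)) + 2 * x * w' * (Q - 2 * w + 4 * x * w^2)"
    by (simp add: algebra_simps power2_eq_square)
  also have "2 * x * w' = (1 - 2 * w + x * w^2) / (1 - x)"
    using assms by (simp add: w'_def)
  also have "- 1 / (2 * (1 - x)) + ((2 * w * Q - 2 * x * w * (1 - 2 * w^2)) + 
      (1 - 2 * w + x * w^2) / (1 - x) * (Q - 2 * w + 4 * x * w^2)) / (Q * Q)
    = (2 * (1 - x) * (2 * w * Q - 2 * x * w * (1 - 2 * w^2)) + 
      2 * (1 - 2 * w + x * w^2) * (Q - 2 * w + 4 * x * w^2) - Q^2) / (2 * (1 - x) * Q^2)"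
    using assms Q by (simp add: divide_simps) (simp add: algebra_simps power2_eq_square)
  \<comment> \<open>The numerator contains a factor \<open>1 - x\<close>, which cancels the pole
    shared by the logarithm and the Riccati equation.\<close>
  also have "2 * (1 - x) * (2 * w * Q - 2 * x * w * (1 - 2 * w^2)) + 
      2 * (1 - 2 * w + x * w^2) * (Q - 2 * w + 4 * x * w^2) - Q^2
    = (1 - x) * - ((6 * x - 4) * w^2 - 4 * w + 3 - x)"
    unfolding Q_def by (simp add: algebra_simps power2_eq_square)
  also have "\<dots> / (2 * (1 - x) * Q^2) =
      ((1 - x) * - ((6 * x - 4) * w^2 - 4 * w + 3 - x)) / ((1 - x) * (2 * Q^2))"
    by (simp only: mult_ac)
  also have "\<dots> = - ((6 * x - 4) * w^2 - 4 * w + 3 - x) / (2 * Q^2)"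
    using assms by (intro mult_divide_mult_cancel_left) auto
  finally show ?thesis by (simp add: Q_def w_def)
qed

lemma ellH_strict_antimono:
  assumes "0 < x" "x < y" "y < 1"
  shows "ellH y < ellH x"
proof (rule DERIV_neg_imp_decreasing[OF assms(2)])
  fix z assume z: "x \<le> z" "z \<le> y"
  with assms have z: "0 < z" "z < 1" by auto
  have "- ((6 * z - 4) * (ellW z)^2 - 4 * ellW z + 3 - z)
     / (2 * (2 * ellW z - 1 + z * (1 - 2 * (ellW z)^2))^2) < 0"
    using ellW_barrier[OF z] ellH_denominator_pos[OF z] by (intro divide_neg_pos) auto
  with ellH_has_derivative[OF z]
  show "\<exists>d. (ellH has_real_derivative d) (at z) \<and> d < 0" by blast
qed

text \<open>The fraction in \<open>ellH\<close> is 0/0 at the origin. Dividing through by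
  \<open>x\<close> turns \<open>2 * w - 1\<close> into twice the difference quotient
  \<open>g\<close>, so the denominator tends to 1/8 + 1/2 = 5/8.\<close>

lemma ellH_tendsto_at_0: "(ellH \<longlongrightarrow> 8/5) (at_right 0)"
proof -
  have W: "(ellW \<longlongrightarrow> 1/2) (at_right 0)"
    using DERIV_isCont[OF ellW_has_derivative_0] ellW_0
    by (auto simp: isCont_def intro: tendsto_within_subset)
  define g where "g = (\<lambda>x. (ellW x - 1/2) / x)"
  have g: "(g \<longlongrightarrow> 1/16) (at_right 0)"
    unfolding g_def using ellW_has_derivative_0 ellW_0
    by (auto simp: has_field_derivative_iff intro: tendsto_within_subset)
  have "((\<lambda>x. ln (1 - x) / 2 + 2 * ellW x / (2 * g x + (1 - 2 * (ellW x)^2)))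
     \<longlongrightarrow> ln (1 - 0) / 2 + 2 * (1/2) / (2 * (1/16) + (1 - 2 * (1/2)^2))) (at_right 0)"
    by (intro tendsto_intros W g) (auto simp: power2_eq_square)
  moreover have "eventually (\<lambda>x. ln (1 - x) / 2 + 2 * ellW x / (2 * g x + (1 - 2 * (ellW x)^2)) = ellH x) (at_right 0)"
  proof (rule eventually_at_rightI[of 0 1])
    fix x :: real assume x: "x \<in> {0<..<1}"
    then have "2 * g x + (1 - 2 * (ellW x)^2) = (2 * ellW x - 1 + x * (1 - 2 * (ellW x)^2)) / x"
      by (simp add: g_def field_simps)
    then show "ln (1 - x) / 2 + 2 * ellW x / (2 * g x + (1 - 2 * (ellW x)^2)) = ellH x"
      by (simp add: ellH_def mult_ac)
  qed simp
  ultimately show ?thesis by (simp add: filterlim_cong power2_eq_square)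
qed

section \<open>Asymptotics at the singularity\<close>

text \<open>The inverse Gudermannian in \<open>arsinh\<close> form; \<open>1 / cos\<close> dominates
  the integrand of \<open>K\<close> and is close to it away from \<open>pi/2\<close>.\<close>

lemma has_integral_secant:
  fixes t :: real
  assumes "0 \<le> t" "t < pi/2"
  shows "((\<lambda>s. 1 / cos s) has_integral arsinh (tan t)) {0..t}"
proof -
  have "((\<lambda>s. 1 / cos s) has_integral arsinh (tan t) - arsinh (tan 0)) {0..t}"
  proof (rule fundamental_theorem_of_calculus[OF assms(1)])
    fix s assume "s \<in> {0..t}"
    then have c: "cos s > 0" using assms by (intro cos_gt_zero_pi) auto
    have "sqrt ((tan s)^2 + 1) = inverse (cos s)"
      using c tan_sec[of s] by (simp add: add.commute real_sqrt_inverse flip: power_inverse)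
    moreover have "((\<lambda>s. arsinh (tan s)) has_field_derivative
        1 / sqrt ((tan s)^2 + 1) * inverse ((cos s)^2)) (at s within {0..t})"
      using c by (intro DERIV_chain2[OF arsinh_real_has_field_derivative] DERIV_subset[OF DERIV_tan]) auto
    ultimately show "((\<lambda>s. arsinh (tan s)) has_vector_derivative 1 / cos s) (at s within {0..t})"
      using c by (simp add: power2_eq_square field_simps flip: has_real_derivative_iff_has_vector_derivative)
  qed
  then show ?thesis by simp
qed

text \<open>With \<open>x = 1 - q^4\<close> the complementary modulus is \<open>q^2\<close>, so no
  roots appear at the splitting point \<open>tan t = 1/q\<close>.\<close>

lemma modulus_eq:
  fixes q t :: real
  shows "1 - (1 - q^4) * (sin t)^2 = (cos t)^2 + q^4 * (sin t)^2"
  by (simp add: cos_squared_eq algebra_simps)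

text \<open>The image of the secant integral under \<open>tan u = 1 / (q^2 * tan s)\<close>,
  verified by its primitive instead of by a change of variables.\<close>

lemma has_integral_cosecant_over_modulus:
  fixes q t :: real
  assumes "q > 0" "0 < t" "t \<le> pi/2"
  shows "((\<lambda>s. 1 / (sin s * sqrt ((cos s)^2 + q^4 * (sin s)^2))) has_integral arsinh (cos t / (q^2 * sin t))) {t..pi/2}"
proof -
  let ?B = "\<lambda>s. - arsinh (cos s / (q^2 * sin s))"
  have "((\<lambda>s. 1 / (sin s * sqrt ((cos s)^2 + q^4 * (sin s)^2))) has_integral ?B (pi/2) - ?B t) {t..pi/2}"
  proof (rule fundamental_theorem_of_calculus[OF assms(3)])
    fix s assume "s \<in> {t..pi/2}"
    then have s: "sin s > 0" using assms by (intro sin_gt_zero) auto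
    define r where "r = sqrt ((cos s)^2 + q^4 * (sin s)^2)"
    have r: "r > 0" unfolding r_def using s assms by (simp add: add_nonneg_pos)
    have "(cos s / (q^2 * sin s))^2 + 1 = ((cos s)^2 + q^4 * (sin s)^2) / (q^2 * sin s)^2"
      using s assms by (simp add: field_simps)
    then have sq: "sqrt ((cos s / (q^2 * sin s))^2 + 1) = r / (q^2 * sin s)"
      using s assms by (simp add: real_sqrt_divide r_def)
    have "((\<lambda>s. cos s / (q^2 * sin s)) has_field_derivative
       (- sin s * (q^2 * sin s) - cos s * (q^2 * cos s)) / (q^2 * sin s * (q^2 * sin s))) (at s within {t..pi/2})"
      using s assms by (intro DERIV_divide DERIV_cmult DERIV_subset[OF DERIV_cos] DERIV_subset[OF DERIV_sin]) auto
    also have "- sin s * (q^2 * sin s) - cos s * (q^2 * cos s) = - (q^2 * ((sin s)^2 + (cos s)^2))"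
      by algebra
    also have "\<dots> = - (q^2)" by simp
    finally have d: "((\<lambda>s. cos s / (q^2 * sin s)) has_field_derivative
       - (q^2) / (q^2 * sin s * (q^2 * sin s))) (at s within {t..pi/2})" .
    have "(?B has_field_derivative - (1 / sqrt ((cos s / (q^2 * sin s))^2 + 1) * (- (q^2) / (q^2 * sin s * (q^2 * sin s)))))
       (at s within {t..pi/2})"
      by (intro DERIV_minus DERIV_chain2[OF arsinh_real_has_field_derivative] d)
    also have "- (1 / sqrt ((cos s / (q^2 * sin s))^2 + 1) * (- (q^2) / (q^2 * sin s * (q^2 * sin s)))) = 1 / (sin s * r)"
      unfolding sq using s assms r by (simp add: divide_simps power2_eq_square)
    finally show "(?B has_vector_derivative 1 / (sin s * sqrt ((cos s)^2 + q^4 * (sin s)^2))) (at s within {t..pi/2})"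
      by (simp add: r_def has_real_derivative_iff_has_vector_derivative)
  qed
  then show ?thesis by simp
qed

text \<open>The substitution \<open>tan t \<mapsto> 1 / (q\<^sup>2 tan t)\<close> preserves the integrand of \<open>K(1 - q\<^sup>4)\<close>; its fixed
  point \<open>tan t = 1/q\<close> splits the integral into two halves, each close to \<open>arsinh (1/q)\<close>.\<close>

lemma ellK_bounds:
  fixes q :: real
  assumes q: "q > 0"
  shows "2 * arsinh (1/q) / sqrt (1 + q^2) \<le> ellK (1 - q^4)" "ellK (1 - q^4) \<le> 2 * arsinh (1/q)"
proof -
  define \<Delta> where "\<Delta> = (\<lambda>t. sqrt ((cos t)^2 + q^4 * (sin t)^2))"
  define c where "c = 1 / sqrt (1 + q^2)"
  define t where "t = arctan (1/q)"
  have t: "0 < t" "t < pi/2" "tan t = 1/q" using q arctan_ubound by (auto simp: t_def tan_arctan)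
  have "sin t = (1/q) / sqrt (1 + (1/q)^2)" by (simp add: t_def sin_arctan)
  also have "1 + (1/q)^2 = (1 + q^2) / q^2" using q by (simp add: field_simps)
  finally have sin_t: "sin t = c" using q by (simp add: real_sqrt_divide c_def)
  \<comment> \<open>The argument equals \<open>tan t\<close>, so both halves are compared with the
    same value \<open>arsinh (1/q)\<close>.\<close>
  have cot: "cos t / (q^2 * sin t) = 1/q"
  proof -
    have "sin t = cos t / q" "cos t > 0" using t cos_gt_zero[of t] by (auto simp: tan_def field_simps)
    then show ?thesis using q by (simp add: power2_eq_square)
  qed
  have c: "c \<ge> 0" by (simp add: c_def)
  have \<Delta>: "1 - (1 - q^4) * (sin s)^2 = (cos s)^2 + q^4 * (sin s)^2" for s by (rule modulus_eq)
  have pos: "\<Delta> s > 0" for s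
    using modulus_pos[of "1 - q^4" s] q unfolding \<Delta> \<Delta>_def by simp
  have int: "((\<lambda>s. 1 / \<Delta> s) has_integral ellK (1 - q^4)) {0..pi/2}"
    using moment_integrable[of "1 - q^4" 0 1 0 "pi/2", THEN integrable_integral] q
    unfolding ellK_def \<Delta> \<Delta>_def by simp
  have i: "(\<lambda>s. 1 / \<Delta> s) integrable_on {a..b}" for a b
    using moment_integrable[of "1 - q^4" 0 1 a b] q unfolding \<Delta> \<Delta>_def by simp
  define I J where "I = integral {0..t} (\<lambda>s. 1 / \<Delta> s)" and "J = integral {t..pi/2} (\<lambda>s. 1 / \<Delta> s)"
  have K: "ellK (1 - q^4) = I + J"
    using Henstock_Kurzweil_Integration.integral_combine[OF _ _ i, of 0 t "pi/2"] t integral_unique[OF int] by (simp add: I_def J_def)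
  have hI: "((\<lambda>s. 1 / \<Delta> s) has_integral I) {0..t}" and hJ: "((\<lambda>s. 1 / \<Delta> s) has_integral J) {t..pi/2}"
    unfolding I_def J_def by (intro integrable_integral i)+
  have sec: "((\<lambda>s. 1 / cos s) has_integral arsinh (1/q)) {0..t}"
    using has_integral_secant[of t] t by simp
  have csc: "((\<lambda>s. 1 / (sin s * \<Delta> s)) has_integral arsinh (1/q)) {t..pi/2}"
    using has_integral_cosecant_over_modulus[of q t] t q unfolding \<Delta>_def cot by simp
  \<comment> \<open>Up to the splitting point \<open>q * sin s \<le> cos s\<close>, so
    \<open>\<Delta> s\<close> lies between \<open>cos s\<close> and
    \<open>sqrt (1 + q^2) * cos s\<close>.\<close>
  have near0: "c * (1 / cos s) \<le> 1 / \<Delta> s" "1 / \<Delta> s \<le> 1 / cos s" if "s \<in> {0..t}" for s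
  proof -
    have cs: "cos s > 0" "sin s \<ge> 0" using that t by (auto intro!: cos_gt_zero_pi sin_ge_zero)
    have "cos s = sqrt ((cos s)^2)" using cs by simp
    also have "\<dots> \<le> \<Delta> s" unfolding \<Delta>_def using q by (intro real_sqrt_le_mono) simp
    finally show "1 / \<Delta> s \<le> 1 / cos s" using cs by (intro divide_left_mono) (auto intro: pos)
    have "tan s = sin s / cos s" by (simp add: tan_def)
    moreover have "tan s \<le> tan t" using that t by (intro tan_mono_le) auto
    ultimately have "sin s / cos s \<le> 1 / q" by (simp only: t(3))
    then have "q * sin s \<le> cos s" using cs q by (simp add: field_simps)
    then have "(q * sin s)^2 \<le> (cos s)^2" using cs q by (intro power_mono) auto
    then have "q^2 * (q * sin s)^2 \<le> q^2 * (cos s)^2" by (intro mult_left_mono) auto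
    then have "(cos s)^2 + q^4 * (sin s)^2 \<le> (1 + q^2) * (cos s)^2"
      by (simp add: power_mult_distrib algebra_simps flip: power_add)
    then have "\<Delta> s \<le> sqrt ((1 + q^2) * (cos s)^2)" unfolding \<Delta>_def by (rule real_sqrt_le_mono)
    then have "\<Delta> s \<le> sqrt (1 + q^2) * cos s" using cs by (simp add: real_sqrt_mult)
    then have "1 / (sqrt (1 + q^2) * cos s) \<le> 1 / \<Delta> s" using pos[of s] by (intro divide_left_mono) auto
    then show "c * (1 / cos s) \<le> 1 / \<Delta> s" by (simp add: c_def)
  qed
  \<comment> \<open>Beyond the splitting point \<open>c = sin t \<le> sin s \<le> 1\<close>.\<close>
  have near1: "c * (1 / (sin s * \<Delta> s)) \<le> 1 / \<Delta> s" "1 / \<Delta> s \<le> 1 / (sin s * \<Delta> s)" if "s \<in> {t..pi/2}" for s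
  proof -
    have s: "sin s > 0" using that t by (intro sin_gt_zero) auto
    have "sin t \<le> sin s" using that t by (intro sin_monotone_2pi_le) auto
    then have "c / sin s \<le> 1" using s sin_t by simp
    then have "c / sin s * (1 / \<Delta> s) \<le> 1 * (1 / \<Delta> s)"
      using pos[of s] by (intro mult_right_mono) (auto simp: less_imp_le)
    then show "c * (1 / (sin s * \<Delta> s)) \<le> 1 / \<Delta> s" by simp
    have "sin s * \<Delta> s \<le> 1 * \<Delta> s" using pos[of s] by (intro mult_right_mono) auto
    then show "1 / \<Delta> s \<le> 1 / (sin s * \<Delta> s)" using s pos[of s] by (intro divide_left_mono) auto
  qed
  have "c * arsinh (1/q) \<le> I"
    by (rule has_integral_le[OF has_integral_mult_right[OF sec] hI near0(1)])
  moreover have "c * arsinh (1/q) \<le> J"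
    by (rule has_integral_le[OF has_integral_mult_right[OF csc] hJ near1(1)])
  moreover have "I \<le> arsinh (1/q)" by (rule has_integral_le[OF hI sec near0(2)])
  moreover have "J \<le> arsinh (1/q)" by (rule has_integral_le[OF hJ csc near1(2)])
  moreover have "2 * arsinh (1/q) / sqrt (1 + q^2) = c * arsinh (1/q) + c * arsinh (1/q)"
    by (simp add: c_def)
  ultimately show "2 * arsinh (1/q) / sqrt (1 + q^2) \<le> ellK (1 - q^4)" "ellK (1 - q^4) \<le> 2 * arsinh (1/q)"
    unfolding K by linarith+
qed

text \<open>\<open>K - x * D\<close> is the complete integral of the second kind, the integral of
  \<open>\<Delta>\<close>; the bounds integrate
  \<open>cos t \<le> \<Delta> t \<le> cos t + q^2 * sin t\<close>.\<close>

lemma ellE_bounds: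
  fixes q :: real
  assumes q: "q > 0"
  defines "E \<equiv> ellK (1 - q^4) - (1 - q^4) * ellD (1 - q^4)"
  shows "1 \<le> E" "E \<le> 1 + q^2"
proof -
  define \<Delta> where "\<Delta> = (\<lambda>t. sqrt ((cos t)^2 + q^4 * (sin t)^2))"
  have \<Delta>: "1 - (1 - q^4) * (sin s)^2 = (cos s)^2 + q^4 * (sin s)^2" for s by (rule modulus_eq)
  note I = moment_integrable[of "1 - q^4" _ 1 0 "pi/2", THEN integrable_integral]
  have "((\<lambda>t. 1 / \<Delta> t - (1 - q^4) * ((sin t)^2 / \<Delta> t)) has_integral E) {0..pi/2}"
    using has_integral_diff[OF I[of 0] has_integral_mult_right[OF I[of 2]]] q
    unfolding \<Delta> E_def ellK_def ellD_def \<Delta>_def by simp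
  moreover have "1 / \<Delta> t - (1 - q^4) * ((sin t)^2 / \<Delta> t) = \<Delta> t" for t
  proof -
    have p: "(cos t)^2 + q^4 * (sin t)^2 > 0"
      using modulus_pos[of "1 - q^4" t] q unfolding \<Delta> by simp
    have "1 / \<Delta> t - (1 - q^4) * ((sin t)^2 / \<Delta> t) = (1 - (1 - q^4) * (sin t)^2) / \<Delta> t"
      by (simp add: diff_divide_distrib)
    also have "\<dots> = \<Delta> t" unfolding \<Delta> \<Delta>_def using p by (simp add: real_div_sqrt)
    finally show ?thesis .
  qed
  ultimately have E: "(\<Delta> has_integral E) {0..pi/2}" by simp
  have "(cos has_integral sin (pi/2) - sin 0) {0..pi/2}"
    by (rule fundamental_theorem_of_calculus)
       (auto intro!: derivative_eq_intros simp flip: has_real_derivative_iff_has_vector_derivative)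
  then have C: "(cos has_integral 1) {0..pi/2}" by simp
  have "(sin has_integral - cos (pi/2) - - cos 0) {0..pi/2}"
    by (rule fundamental_theorem_of_calculus)
       (auto intro!: derivative_eq_intros simp flip: has_real_derivative_iff_has_vector_derivative)
  then have S: "(sin has_integral 1) {0..pi/2}" by simp
  have bounds: "cos t \<le> \<Delta> t" "\<Delta> t \<le> cos t + q^2 * sin t" if "t \<in> {0..pi/2}" for t
  proof -
    have cs: "cos t \<ge> 0" "sin t \<ge> 0" using that by (auto intro!: cos_ge_zero sin_ge_zero)
    show "cos t \<le> \<Delta> t" unfolding \<Delta>_def by (rule real_le_rsqrt) simp
    have "(cos t)^2 + q^4 * (sin t)^2 \<le> (cos t + q^2 * sin t)^2"
      using cs by (simp add: power2_sum power_mult_distrib flip: power_mult)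
    then show "\<Delta> t \<le> cos t + q^2 * sin t" unfolding \<Delta>_def
      using cs by (intro real_le_lsqrt) auto
  qed
  show "1 \<le> E" by (rule has_integral_le[OF C E bounds(1)])
  show "E \<le> 1 + q^2"
    using has_integral_le[OF E has_integral_add[OF C has_integral_mult_right[OF S]] bounds(2)] by simp
qed

text \<open>As \<open>w\<close> tends to 1, the denominator \<open>Q\<close> of \<open>ellH\<close>
  tends to 0, but \<open>K * Q\<close> tends to 2. The fraction is therefore written as
  \<open>K\<close> plus a vanishing remainder, and \<open>K + ln (1 - x) / 2\<close> supplies the
  limit.\<close>

lemma ellH_tendsto_at_1: "(ellH \<longlongrightarrow> ln 4) (at_left 1)"
proof -
  define x where "x = (\<lambda>q::real. 1 - q^4)"
  define K where "K = (\<lambda>q. ellK (x q))"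
  define W where "W = (\<lambda>q. ellW (x q))"
  define E where "E = (\<lambda>q. K q * (1 - x q * W q))"
  define L where "L = (\<lambda>q::real. 2 * arsinh (1/q))"
  have ev: "eventually (\<lambda>q::real. 0 < q \<and> q < 1) (at_right 0)"
    by (rule eventually_at_rightI[of 0 1]) auto
  have bounds: "L q / sqrt (1 + q^2) \<le> K q" "K q \<le> L q" "1 \<le> E q" "E q \<le> 1 + q^2" "0 < K q" "0 < x q" "x q < 1" "L q > 0"
    if "0 < q" "q < 1" for q
  proof -
    have x: "x q < 1" "x q > 0" using that by (auto simp: x_def power_less_one_iff)
    show "0 < K q" "0 < x q" "x q < 1" using x ellK_pos by (auto simp: K_def)
    have "E q = ellK (x q) - x q * ellD (x q)"
      using ellK_pos[OF x(1)] by (simp add: E_def K_def W_def ellW_def algebra_simps)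
    then show "1 \<le> E q" "E q \<le> 1 + q^2" using ellE_bounds[OF that(1)] by (simp_all add: x_def)
    show "L q / sqrt (1 + q^2) \<le> K q" "K q \<le> L q"
      using ellK_bounds[OF that(1)] by (simp_all add: K_def L_def x_def)
    then show "L q > 0" using \<open>0 < K q\<close> by linarith
  qed
  have KL: "((\<lambda>q. K q - L q) \<longlongrightarrow> 0) (at_right 0)"
  proof (rule tendsto_sandwich)
    show "eventually (\<lambda>q. L q / sqrt (1 + q^2) - L q \<le> K q - L q) (at_right 0)"
      "eventually (\<lambda>q. K q - L q \<le> 0) (at_right 0)"
      using ev by (eventually_elim, use bounds in force)+
    show "((\<lambda>q. L q / sqrt (1 + q^2) - L q) \<longlongrightarrow> 0) (at_right 0)"
      unfolding L_def arsinh_real_def by real_asymp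
  qed auto
  have EK: "((\<lambda>q. E q / K q) \<longlongrightarrow> 0) (at_right 0)"
  proof (rule tendsto_sandwich)
    show "eventually (\<lambda>q. 0 \<le> E q / K q) (at_right 0)"
      using ev by eventually_elim (use bounds in \<open>force intro!: divide_nonneg_pos\<close>)
    show "eventually (\<lambda>q. E q / K q \<le> (1 + q^2) / (L q / sqrt (1 + q^2))) (at_right 0)"
      using ev
    proof eventually_elim
      case (elim q)
      then show ?case using bounds[of q]
        by (intro frac_le divide_pos_pos) (auto intro: add_pos_nonneg)
    qed
    show "((\<lambda>q. (1 + q^2) / (L q / sqrt (1 + q^2))) \<longlongrightarrow> 0) (at_right 0)"
      unfolding L_def arsinh_real_def by real_asymp
  qed auto
  have q4: "((\<lambda>q. x q) \<longlongrightarrow> 1) (at_right 0)" unfolding x_def by real_asymp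
  have E1: "(E \<longlongrightarrow> 1) (at_right 0)"
  proof (rule tendsto_sandwich)
    show "eventually (\<lambda>q. 1 \<le> E q) (at_right 0)" "eventually (\<lambda>q. E q \<le> 1 + q^2) (at_right 0)"
      using ev by (eventually_elim, use bounds in force)+
    show "((\<lambda>q. 1 + q^2) \<longlongrightarrow> (1::real)) (at_right 0)" by real_asymp
  qed auto
  \<comment> \<open>Solving \<open>E = K * (1 - x * W)\<close> for \<open>W\<close> reduces this to
    \<open>E / K \<longlongrightarrow> 0\<close>.\<close>
  have W1: "(W \<longlongrightarrow> 1) (at_right 0)"
  proof -
    have "((\<lambda>q. (1 - E q / K q) / x q) \<longlongrightarrow> (1 - 0) / 1) (at_right 0)"
      by (intro tendsto_intros EK q4) auto
    moreover have "eventually (\<lambda>q. (1 - E q / K q) / x q = W q) (at_right 0)"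
      using ev
    proof eventually_elim
      case (elim q)
      then show ?case using bounds(5,6)[of q] by (simp add: E_def)
    qed
    ultimately show ?thesis by (simp add: filterlim_cong)
  qed
  \<comment> \<open>Here \<open>E - x\<close> is at most \<open>q^2 + q^4\<close>, which beats the
    logarithmic growth of \<open>K\<close>.\<close>
  have EKx: "((\<lambda>q. (E q - x q) * K q) \<longlongrightarrow> 0) (at_right 0)"
  proof (rule tendsto_sandwich)
    show "eventually (\<lambda>q. 0 \<le> (E q - x q) * K q) (at_right 0)"
      "eventually (\<lambda>q. (E q - x q) * K q \<le> (q^2 + q^4) * L q) (at_right 0)"
    proof -
      show "eventually (\<lambda>q. 0 \<le> (E q - x q) * K q) (at_right 0)" using ev
      proof eventually_elim
        case (elim q)
        then show ?case using bounds[of q] by (intro mult_nonneg_nonneg) linarith+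
      qed
      show "eventually (\<lambda>q. (E q - x q) * K q \<le> (q^2 + q^4) * L q) (at_right 0)" using ev
      proof eventually_elim
        case (elim q)
        have "E q - x q \<le> q^2 + q^4" using bounds(4)[of q] elim by (simp add: x_def)
        then show ?case using bounds[of q] elim by (intro mult_mono) auto
      qed
    qed
    show "((\<lambda>q. (q^2 + q^4) * L q) \<longlongrightarrow> 0) (at_right 0)"
      unfolding L_def arsinh_real_def by real_asymp
  qed auto
  \<comment> \<open>Exponent 2 occurs in the numerator of the remainder and exponent 1 in its
    denominator.\<close>
  have yK: "((\<lambda>q. q^4 * K q ^ k) \<longlongrightarrow> 0) (at_right 0)" if "k = 1 \<or> k = 2" for k
  proof (rule tendsto_sandwich)
    show "eventually (\<lambda>q. 0 \<le> q^4 * K q ^ k) (at_right 0)" using ev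
      by eventually_elim (use bounds(5) in \<open>auto simp: less_imp_le\<close>)
    show "eventually (\<lambda>q. q^4 * K q ^ k \<le> q^4 * L q ^ k) (at_right 0)" using ev
      by eventually_elim (use bounds(2,5) in \<open>auto intro!: mult_left_mono power_mono simp: less_imp_le\<close>)
    show "((\<lambda>q. q^4 * L q ^ k) \<longlongrightarrow> 0) (at_right 0)"
      using that unfolding L_def arsinh_real_def by (elim disjE; simp only:; real_asymp)
  qed auto
  \<comment> \<open>For small \<open>q\<close>, \<open>arsinh (1/q)\<close> behaves like
    \<open>ln (2/q)\<close>, so \<open>ln q\<close> cancels and \<open>2 * ln 2\<close>
    remains.\<close>
  have "((\<lambda>q. L q + ln (q^4) / 2) \<longlongrightarrow> ln 4) (at_right 0)"
  proof -
    have "((\<lambda>q. L q + ln (q^4) / 2) \<longlongrightarrow> 2 * ln 2) (at_right 0)"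
      unfolding L_def arsinh_real_def by real_asymp
    also have "2 * ln 2 = ln (4::real)" using ln_realpow[of 2 2] by simp
    finally show ?thesis .
  qed
  then have "((\<lambda>q. (L q + ln (q^4) / 2) + (K q - L q) + (q^4 * K q ^ 2 - 2 * W q * ((E q - x q) * K q)) / (2 * W q * E q - q^4 * K q ^ 1))
     \<longlongrightarrow> ln 4 + 0 + (0 - 2 * 1 * 0) / (2 * 1 * 1 - 0)) (at_right 0)"
    by (intro tendsto_intros KL E1 W1 EKx yK) auto
  moreover have "eventually (\<lambda>q. (L q + ln (q^4) / 2) + (K q - L q) + (q^4 * K q ^ 2 - 2 * W q * ((E q - x q) * K q)) / (2 * W q * E q - q^4 * K q ^ 1)
      = ellH (1 - q^4)) (at_right 0)"
    using ev
  proof eventually_elim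
    case (elim q)
    note b = bounds[OF elim[THEN conjunct1] elim[THEN conjunct2]]
    define Q where "Q = 2 * W q - 1 + x q * (1 - 2 * (W q)^2)"
    have Q: "Q > 0" using ellH_denominator_pos[OF b(6,7)] by (simp add: Q_def W_def)
    have q4: "q^4 = 1 - x q" by (simp add: x_def)
    \<comment> \<open>The right side is the form in which the denominator is known positive; the
      left side is the form whose limit is visible.\<close>
    have den: "2 * W q * E q - q^4 * K q ^ 1 = K q * Q"
      unfolding q4 Q_def E_def by (simp add: algebra_simps power2_eq_square)
    have "K q + (q^4 * K q ^ 2 - 2 * W q * ((E q - x q) * K q)) / (K q * Q)
        = (K q * Q + q^4 * K q - 2 * W q * (E q - x q)) / Q"
      using b(5) Q by (simp add: field_simps power2_eq_square)
    also have "K q * Q + q^4 * K q - 2 * W q * (E q - x q) = 2 * x q * W q"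
      unfolding q4 Q_def E_def by (simp add: algebra_simps power2_eq_square)
    finally have "K q + (q^4 * K q ^ 2 - 2 * W q * ((E q - x q) * K q)) / (K q * Q) = 2 * x q * W q / Q" .
    then show ?case unfolding den by (simp add: ellH_def Q_def W_def x_def)
  qed
  ultimately have "((\<lambda>q. ellH (1 - q^4)) \<longlongrightarrow> ln 4) (at_right 0)" by (simp add: filterlim_cong)
  \<comment> \<open>The substitution \<open>q = (1 - x)\<close> to the power 1/4 returns to the
    variable \<open>x\<close>.\<close>
  moreover have "filterlim (\<lambda>x::real. sqrt (sqrt (1 - x))) (at_right 0) (at_left 1)" by real_asymp
  ultimately have "((\<lambda>x. ellH (1 - sqrt (sqrt (1 - x))^4)) \<longlongrightarrow> ln 4) (at_left 1)"
    by (rule filterlim_compose)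
  moreover have "eventually (\<lambda>x. ellH (1 - sqrt (sqrt (1 - x))^4) = ellH x) (at_left 1)"
  proof (rule eventually_at_leftI[of 0])
    fix x :: real assume "x \<in> {0<..<1}"
    then have "sqrt (sqrt (1 - x))^4 = 1 - x"
      using power_mult[of "sqrt (sqrt (1 - x))" 2 2] by simp
    then show "ellH (1 - sqrt (sqrt (1 - x))^4) = ellH x" by simp
  qed simp
  ultimately show ?thesis by (simp add: filterlim_cong)
qed

section \<open>Convexity of the quotient\<close>

text \<open>The limit at 0 gives only a weak bound; applying it at \<open>x/2\<close> and using
  strict decrease makes it strict. \<open>ellH_greater\<close> does the same at the other
  end.\<close>

lemma ellH_less:
  assumes "0 < x" "x < 1"
  shows "ellH x < 8/5"
proof -
  have "eventually (\<lambda>y. ellH (x/2) \<le> ellH y) (at_right 0)"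
    using assms by (intro eventually_at_rightI[of 0 "x/2"]) (auto intro!: less_imp_le ellH_strict_antimono)
  then have "ellH (x/2) \<le> 8/5"
    by (intro tendsto_lowerbound[OF ellH_tendsto_at_0]) auto
  moreover have "ellH x < ellH (x/2)" using assms by (intro ellH_strict_antimono) auto
  ultimately show ?thesis by simp
qed

lemma ellH_greater:
  assumes "0 < x" "x < 1"
  shows "ln 4 < ellH x"
proof -
  define z where "z = (x + 1) / 2"
  have z: "x < z" "z < 1" using assms by (auto simp: z_def)
  have "eventually (\<lambda>y. ellH y \<le> ellH z) (at_left 1)"
    using z assms by (intro eventually_at_leftI[of z]) (auto intro!: less_imp_le ellH_strict_antimono)
  then have "ln 4 \<le> ellH z"
    by (intro tendsto_upperbound[OF ellH_tendsto_at_1]) auto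
  moreover have "ellH z < ellH x" using assms z by (intro ellH_strict_antimono) auto
  ultimately show ?thesis by simp
qed

text \<open>By the mean value theorem the chord slopes on either side of the intermediate point are
  values of \<open>f'\<close>, which increases strictly.\<close>

lemma strictly_convex_on_greaterThanLessThan:
  fixes f f' f'' :: "real \<Rightarrow> real"
  assumes f: "\<And>x. l < x \<Longrightarrow> x < r \<Longrightarrow> (f has_field_derivative f' x) (at x)"
    and f': "\<And>x. l < x \<Longrightarrow> x < r \<Longrightarrow> (f' has_field_derivative f'' x) (at x)"
    and f'': "\<And>x. l < x \<Longrightarrow> x < r \<Longrightarrow> f'' x > 0"
  shows "strictly_convex_on {l<..<r} f"
proof -
  have ord: "f (u * x + (1 - u) * y) < u * f x + (1 - u) * f y"
    if x: "l < x" and xy: "x < y" and y: "y < r" and u: "0 < u" "u < 1" for x y u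
  proof -
    define z where "z = u * x + (1 - u) * y"
    have zx: "z - x = (1 - u) * (y - x)" and yz: "y - z = u * (y - x)"
      by (auto simp: z_def algebra_simps)
    have "z - x > 0" "y - z > 0" unfolding zx yz using u xy by auto
    then have z: "x < z" "z < y" by auto
    obtain \<xi> where \<xi>: "x < \<xi>" "\<xi> < z" "f z - f x = (z - x) * f' \<xi>"
      using MVT2[of x z f f', OF z(1)] z x y f by force
    obtain \<eta> where \<eta>: "z < \<eta>" "\<eta> < y" "f y - f z = (y - z) * f' \<eta>"
      using MVT2[of z y f f', OF z(2)] z x y f by force
    have "f' \<xi> < f' \<eta>"
    proof (rule DERIV_pos_imp_increasing[of \<xi> \<eta> f'])
      show "\<xi> < \<eta>" using \<xi> \<eta> by simp
      fix s assume "\<xi> \<le> s" "s \<le> \<eta>"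
      then show "\<exists>d. (f' has_real_derivative d) (at s) \<and> 0 < d"
        using f'[of s] f''[of s] \<xi> \<eta> x y by force
    qed
    then have "u * (1 - u) * (y - x) * (f' \<eta> - f' \<xi>) > 0" using u xy by simp
    also have "u * (1 - u) * (y - x) * (f' \<eta> - f' \<xi>) = (1 - u) * (f y - f z) - u * (f z - f x)"
      unfolding \<xi>(3) \<eta>(3) zx yz by (simp add: algebra_simps)
    finally show ?thesis by (simp add: z_def algebra_simps)
  qed
  show ?thesis unfolding strictly_convex_on_def
  proof (intro conjI ballI allI impI)
    show "convex {l<..<r}" by simp
    fix x y u :: real assume "x \<in> {l<..<r}" "y \<in> {l<..<r}" "x \<noteq> y \<and> 0 < u \<and> u < 1"
    then show "f (u * x + (1 - u) * y) < u * f x + (1 - u) * f y"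
      \<comment> \<open>The case \<open>y < x\<close> follows by exchanging the points together with
        the weights \<open>u\<close> and \<open>1 - u\<close>.\<close>
      using ord[of x y u] ord[of y x "1 - u"] by (cases x y rule: linorder_cases) (auto simp: add.commute)
  qed
qed

text \<open>Midpoint inequalities clash. This makes the constants necessary: failure on a short
  interval at one end excludes the property on all of \<open>{0<..<1}\<close>.\<close>

lemma not_strictly_convex_and_strictly_concave:
  assumes "strictly_convex_on S f" "strictly_concave_on T f" "T \<subseteq> S" "x \<in> T" "y \<in> T" "x \<noteq> y"
  shows False
proof -
  have midpoint: "g ((1/2) * x + (1 - 1/2) * y) < (1/2) * g x + (1 - 1/2) * g y"
    if "strictly_convex_on A g" "x \<in> A" "y \<in> A" for A and g :: "real \<Rightarrow> real"
  proof -
    have "x \<noteq> y \<and> 0 < (1/2::real) \<and> (1/2::real) < 1" using assms(6) by simp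
    with that show ?thesis unfolding strictly_convex_on_def by blast
  qed
  have "f ((1/2) * x + (1 - 1/2) * y) < (1/2) * f x + (1 - 1/2) * f y"
    by (rule midpoint[of S]) (use assms in auto)
  moreover have "- f ((1/2) * x + (1 - 1/2) * y) < (1/2) * - f x + (1 - 1/2) * - f y"
    using assms(2,4,5) unfolding strictly_concave_on_def by (rule midpoint)
  ultimately show False by simp
qed

section \<open>The quotient and the sign of its second derivative\<close>

definition quot where "quot a x = (a - ln (1 - x) / 2) / ellK x"

definition quot' where
  "quot' a x = (1 - (a - ln (1 - x) / 2) * (1 - ellW x)) / (2 * (1 - x) * ellK x)"

definition quot'' where
  "quot'' a x = (2 * ellW x - 1 + x * (1 - 2 * (ellW x)^2)) / (4 * x * (1 - x)^2 * ellK x) * (ellH x - a)"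

lemma numerator_has_derivative:
  fixes x :: real
  assumes "x < 1"
  shows "((\<lambda>x. a - ln (1 - x) / 2) has_field_derivative 1 / (2 * (1 - x))) (at x)"
  using assms by (auto intro!: derivative_eq_intros simp: divide_simps)

lemma quot_has_derivative:
  assumes "0 < x" "x < 1"
  shows "(quot a has_field_derivative quot' a x) (at x)"
proof -
  define N where "N = a - ln (1 - x) / 2"
  have K: "ellK x > 0" using assms ellK_pos by simp
  have "(quot a has_field_derivative
     (1 / (2 * (1 - x)) * ellK x - N * (ellK x * (1 - ellW x) / (2 * (1 - x)))) / (ellK x * ellK x)) (at x)"
    unfolding quot_def[abs_def] N_def using assms K
    by (intro DERIV_divide numerator_has_derivative ellK_has_derivative_ellW) auto
  also have "(1 / (2 * (1 - x)) * ellK x - N * (ellK x * (1 - ellW x) / (2 * (1 - x)))) / (ellK x * ellK x) = quot' a x"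
    using assms K unfolding quot'_def N_def[symmetric]
    by (simp add: divide_simps) (simp add: algebra_simps)
  finally show ?thesis .
qed

lemma quot'_has_derivative:
  assumes "0 < x" "x < 1"
  shows "(quot' a has_field_derivative quot'' a x) (at x)"
proof -
  define N where "N = a - ln (1 - x) / 2"
  define w where "w = ellW x"
  define k where "k = ellK x"
  define w' where "w' = (1 - 2 * w + x * w^2) / (2 * x * (1 - x))"
  define Q where "Q = 2 * w - 1 + x * (1 - 2 * w^2)"
  have K: "k > 0" using assms ellK_pos by (simp add: k_def)
  have Q: "Q > 0" using ellH_denominator_pos[OF assms] by (simp add: Q_def w_def)
  have dw: "(ellW has_field_derivative w') (at x)"
    using ellW_has_derivative[OF assms] by (simp add: w_def w'_def)
  have cancel: "c / (2 * x * m) * (2 * m) = c / x" if "0 < m" for c m using that by simp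
  have "((\<lambda>x. 1 - (a - ln (1 - x) / 2) * (1 - ellW x)) has_field_derivative
      0 - (1 / (2 * (1 - x)) * (1 - w) + (0 - w') * N)) (at x)"
    unfolding N_def w_def
    by (intro DERIV_diff DERIV_mult' DERIV_const numerator_has_derivative dw DERIV_mult assms(2))
  moreover have "((\<lambda>x. 2 * (1 - x) * ellK x) has_field_derivative
      (2 * (0 - 1)) * k + k * (1 - w) / (2 * (1 - x)) * (2 * (1 - x))) (at x)"
    unfolding k_def w_def
    by (intro DERIV_mult DERIV_cmult DERIV_diff DERIV_const DERIV_ident ellK_has_derivative_ellW assms(2))
  ultimately have "(quot' a has_field_derivative
     ((0 - (1 / (2 * (1 - x)) * (1 - w) + (0 - w') * N)) * (2 * (1 - x) * k) 
      - (1 - N * (1 - w)) * ((2 * (0 - 1)) * k + k * (1 - w) / (2 * (1 - x)) * (2 * (1 - x))))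
     / ((2 * (1 - x) * k) * (2 * (1 - x) * k))) (at x)"
    unfolding quot'_def[abs_def] N_def k_def w_def using assms K unfolding k_def
    by (intro DERIV_divide) auto
  \<comment> \<open>General \<open>j\<close> and \<open>m\<close> keep \<open>2 * (1 - x)\<close> as
    one factor, so that it cancels in the next two steps.\<close>
  also have "(0 - (j * (1 - w) + (0 - w') * N)) * (m * k) = k * ((w - 1) * (j * m) + N * (w' * m))" for j m
    by algebra
  also have "1 / (2 * (1 - x)) * (2 * (1 - x)) = 1" using assms by simp
  also have "w' * (2 * (1 - x)) = (1 - 2 * w + x * w^2) / x"
    unfolding w'_def by (rule cancel) (use assms in simp)
  also have "(2 * (0 - 1)) * k + k * (1 - w) / (2 * (1 - x)) * (2 * (1 - x)) = - k * (1 + w)"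
  proof -
    have "k * (1 - w) / (2 * (1 - x)) * (2 * (1 - x)) = k * (1 - w)" using assms by simp
    then show ?thesis by (simp add: algebra_simps)
  qed
  \<comment> \<open>The coefficient of \<open>N\<close> is
    \<open>(1 - 2 * w + x * w^2) / x - (1 - w^2) = - Q / x\<close>, the origin of
    \<open>Q\<close>.\<close>
  also have "k * ((w - 1) * 1 + N * ((1 - 2 * w + x * w^2) / x)) - (1 - N * (1 - w)) * (- k * (1 + w))
      = k * ((2 * x * w - N * Q) / x)"
    using assms unfolding Q_def by (simp add: field_simps power2_eq_square)
  also have "k * (B / x) / ((2 * m * k) * (2 * m * k)) = B / (4 * x * m^2 * k)" for B m
    using K by (simp add: power2_eq_square)
  also have "2 * x * w - N * Q = Q * (ellH x - a)"
  proof -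
    have "ellH x = ln (1 - x) / 2 + 2 * x * w / Q" by (simp add: ellH_def Q_def w_def)
    moreover have "Q * (l + c - a) = Q * c - (a - l) * Q" for l c :: real by (simp add: algebra_simps)
    ultimately have "Q * (ellH x - a) = Q * (2 * x * w / Q) - N * Q" by (simp only: N_def)
    then show ?thesis using Q by simp
  qed
  finally show ?thesis unfolding quot''_def by (simp add: Q_def w_def k_def)
qed

lemma quot''_pos_iff:
  assumes "0 < x" "x < 1"
  shows "quot'' a x > 0 \<longleftrightarrow> a < ellH x" "quot'' a x < 0 \<longleftrightarrow> ellH x < a"
proof -
  have "(2 * ellW x - 1 + x * (1 - 2 * (ellW x)^2)) / (4 * x * (1 - x)^2 * ellK x) > 0"
    using assms ellK_pos[of x] ellH_denominator_pos[OF assms] by (intro divide_pos_pos) auto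
  then show "quot'' a x > 0 \<longleftrightarrow> a < ellH x" "quot'' a x < 0 \<longleftrightarrow> ellH x < a"
    unfolding quot''_def by (simp_all only: zero_less_mult_iff mult_less_0_iff) auto
qed

lemma quot_strictly_convex:
  assumes "0 \<le> l" "r \<le> 1" "\<And>x. l < x \<Longrightarrow> x < r \<Longrightarrow> a < ellH x"
  shows "strictly_convex_on {l<..<r} (quot a)"
  using assms
  by (intro strictly_convex_on_greaterThanLessThan[of l r _ "quot' a" "quot'' a"]
      quot_has_derivative quot'_has_derivative) (auto simp: quot''_pos_iff)

lemma quot_strictly_concave:
  assumes "0 \<le> l" "r \<le> 1" "\<And>x. l < x \<Longrightarrow> x < r \<Longrightarrow> ellH x < a"
  shows "strictly_concave_on {l<..<r} (quot a)"
  unfolding strictly_concave_on_def using assms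
  by (intro strictly_convex_on_greaterThanLessThan[of l r _ "\<lambda>x. - quot' a x" "\<lambda>x. - quot'' a x"]
      DERIV_minus quot_has_derivative quot'_has_derivative) (auto simp: quot''_pos_iff)

theorem theorem2:
  fixes a :: real
  shows "(strictly_convex_on {0<..<1} (\<lambda>x. (a - ln (1 - x) / 2) / ellK x) \<longleftrightarrow> a \<le> ln 4)
       \<and> (strictly_concave_on {0<..<1} (\<lambda>x. (a - ln (1 - x) / 2) / ellK x) \<longleftrightarrow> a \<ge> 8 / 5)"
proof -
  have "strictly_convex_on {0<..<1} (quot a) \<longleftrightarrow> a \<le> ln 4"
  proof
    assume convex: "strictly_convex_on {0<..<1} (quot a)"
    show "a \<le> ln 4"
    proof (rule ccontr)
      \<comment> \<open>For such \<open>a\<close>, \<open>ellH\<close> falls below \<open>a\<close>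
        near 1, so the quotient is strictly concave there.\<close>
      assume "\<not> a \<le> ln 4"
      then have "eventually (\<lambda>x. ellH x < a) (at_left 1)"
        by (intro order_tendstoD(2)[OF ellH_tendsto_at_1]) auto
      then obtain b where b: "b < 1" "\<And>x. b < x \<Longrightarrow> x < 1 \<Longrightarrow> ellH x < a"
        by (auto simp: eventually_at_left[of 0 "1::real"])
      define l where "l = max b 0"
      have "strictly_concave_on {l<..<1} (quot a)"
        by (rule quot_strictly_concave) (auto simp: l_def intro: b)
      with convex show False
      proof (rule not_strictly_convex_and_strictly_concave)
        show "{l<..<1} \<subseteq> {0<..<1}" by (auto simp: l_def)
        show "l + (1 - l) / 2 \<in> {l<..<1}" "l + (1 - l) / 3 \<in> {l<..<1}" "l + (1 - l) / 2 \<noteq> l + (1 - l) / 3"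
          using b(1) by (auto simp: l_def field_simps)
      qed
    qed
  next
    assume "a \<le> ln 4"
    then show "strictly_convex_on {0<..<1} (quot a)"
      using ellH_greater by (intro quot_strictly_convex) force+
  qed
  moreover have "strictly_concave_on {0<..<1} (quot a) \<longleftrightarrow> a \<ge> 8/5"
  proof
    assume concave: "strictly_concave_on {0<..<1} (quot a)"
    show "a \<ge> 8/5"
    proof (rule ccontr)
      assume "\<not> a \<ge> 8/5"
      then have "eventually (\<lambda>x. a < ellH x) (at_right 0)"
        by (intro order_tendstoD(1)[OF ellH_tendsto_at_0]) auto
      then obtain b where b: "b > 0" "\<And>x. 0 < x \<Longrightarrow> x < b \<Longrightarrow> a < ellH x"
        by (auto simp: eventually_at_right[of 0 "1::real"])
      define r where "r = min b 1"
      \<comment> \<open>The clash is applied to \<open>- quot a\<close>, convex on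
        \<open>{0<..<1}\<close>, so the local convexity of \<open>quot a\<close> must read as
        concavity of its negative.\<close>
      have "strictly_convex_on {0<..<r} (\<lambda>x. - (- quot a x))"
        using quot_strictly_convex[of 0 r a] b by (simp add: r_def)
      then have "strictly_concave_on {0<..<r} (\<lambda>x. - quot a x)" by (simp add: strictly_concave_on_def)
      with concave[unfolded strictly_concave_on_def] show False
      proof (rule not_strictly_convex_and_strictly_concave)
        show "{0<..<r} \<subseteq> {0<..<1}" by (auto simp: r_def)
        show "r / 2 \<in> {0<..<r}" "r / 3 \<in> {0<..<r}" "r / 2 \<noteq> r / 3"
          using b(1) by (auto simp: r_def)
      qed
    qed
  next
    assume "a \<ge> 8/5"
    then show "strictly_concave_on {0<..<1} (quot a)"
      using ellH_less by (intro quot_strictly_concave) force+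
  qed
  ultimately show ?thesis by (simp add: quot_def[abs_def])
qed

end
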